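(* Let $T=(\omega_1,\prec)$ be a normal, $\omega$-splitting $\omega_1$-tree with levels $T_\alpha=[\omega\alpha,\omega\alpha+\omega)$ for $\alpha<\omega_1$. Then the topological group $G(\mathcal F_T)$ is Fréchet if and only if $T$ is Aronszajn.
   Context: A tree is a strict partial order $(T,\prec)$ in which the set $t_\downarrow=\{s\in T:s\prec t\}$ of predecessors of each $t$ is well-ordered by $\prec$. The height of $t$, $\mathrm{ht}(t)$, is the order type of $t_\downarrow$; $T_\alpha=\{t\in T:\mathrm{ht}(t)=\alpha\}$; $\mathrm{ht}(T)=\min\{\alpha:T_\alpha=\emptyset\}$. $T$ is an $\omega_1$-tree if $\mathrm{ht}(T)=\omega_1$ and every level is countable. $T$ is normal if whenever $s\in T$ and $\mathrm{ht}(s)<\alpha<\mathrm{ht}(T)$ there is $t\in T_\alpha$ with $s\prec t$. $T$ is $\omega$-splitting if every node has at least $\omega$ many immediate successors. An $\omega_1$-tree is Aronszajn if every linearly ordered subset of it is countable. Here the underlying set of $T$ is $\omega_1$, and level $\alpha$ is the ordinal interval $[\omega\alpha,\omega\alpha+\omega)$ (ordinal multiplication $\omega\cdot\alpha$). Let $C=\{\alpha<\omega_1:\omega\alpha=\alpha\}$. For $n<\omega$ and $\alpha\in C$ let $$F^T_n(\alpha)=\{\gamma<\alpha:(\exists m\le n)\ \gamma\prec\alpha+m\},$$ and $\mathcal F_T=\{F^T_n(\alpha):n<\omega,\ \alpha\in C\}$. $G(\mathcal F_T)$ is the topological group $([\omega_1]^{<\omega},\triangle)$ (finite subsets of $\omega_1$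 with symmetric difference) with the group topology for which the sets $\{a\in[\omega_1]^{<\omega}:a\cap F^T_n(\alpha)=\emptyset\}$ ($n<\omega$, $\alpha\in C$) form an open neighborhood base at the identity $\emptyset$. A topological group $G$ with identity $e$ is Fréchet if for every $A\subseteq G$ with $e\in\overline A$ there is a sequence in $A$ converging to $e$. *)

theory Defs
  imports "HOL-Analysis.Analysis" "HOL-Library.Countable_Set_Type" "HOL-Algebra.Group"
begin

unbundle cardinal_syntax

section \<open>The ordinal \<open>\<omega>\<^sub>1\<close> and its arithmetic\<close>

typedef omega1 = "Field (cardSuc natLeq)"
proof -
  have "infinite (Field (cardSuc natLeq))"
    by (simp add: cardSuc_finite natLeq_card_order Field_natLeq natLeq_Card_order)
  then show ?thesis by (metis ex_in_conv finite.emptyI)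
qed

lemma Well_order_cardSuc_natLeq: "Well_order (cardSuc natLeq)"
  using cardSuc_Card_order[OF natLeq_Card_order] card_order_on_well_order_on by blast

instantiation omega1 :: linorder
begin

definition less_eq_omega1 :: "omega1 \<Rightarrow> omega1 \<Rightarrow> bool"
  where "x \<le> y \<longleftrightarrow> (Rep_omega1 x, Rep_omega1 y) \<in> cardSuc natLeq"

definition less_omega1 :: "omega1 \<Rightarrow> omega1 \<Rightarrow> bool"
  where "(x :: omega1) < y \<longleftrightarrow> x \<le> y \<and> x \<noteq> y"

instance
proof -
  let ?r = "cardSuc natLeq"
  have r: "refl_on (Field ?r) ?r" "trans ?r" "antisym ?r" "total_on (Field ?r) ?r"
    using Well_order_cardSuc_natLeq
    by (auto simp: well_order_on_def linear_order_on_def partial_order_on_def preorder_on_def)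
  show "OFCLASS(omega1, linorder_class)"
  proof
    fix x y z :: omega1
    show refl: "x \<le> x"
      using r(1) Rep_omega1[of x] by (auto simp: less_eq_omega1_def refl_on_def)
    show "x \<le> z" if "x \<le> y" "y \<le> z"
      using that r(2) by (auto simp: less_eq_omega1_def dest: transD)
    show antisym: "x = y" if "x \<le> y" "y \<le> x"
      using that r(3) by (auto simp: less_eq_omega1_def Rep_omega1_inject dest: antisymD)
    show "x < y \<longleftrightarrow> x \<le> y \<and> \<not> y \<le> x"
      using antisym refl by (auto simp: less_omega1_def)
    show "x \<le> y \<or> y \<le> x"
      using r(4) Rep_omega1[of x] Rep_omega1[of y] refl
      by (cases "x = y") (auto simp: less_eq_omega1_def total_on_def Rep_omega1_inject)
  qed
qed

end

lemma wf_omega1: "wf {(x, y :: omega1). x < y}"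
proof -
  have "wf (cardSuc natLeq - Id)"
    using Well_order_cardSuc_natLeq by (auto simp: well_order_on_def)
  then have "wf (inv_image (cardSuc natLeq - Id) Rep_omega1)"
    by (rule wf_inv_image)
  moreover have "{(x, y :: omega1). x < y} \<subseteq> inv_image (cardSuc natLeq - Id) Rep_omega1"
    by (auto simp: inv_image_def less_omega1_def less_eq_omega1_def Rep_omega1_inject)
  ultimately show ?thesis by (rule wf_subset)
qed

instance omega1 :: wellorder
proof
  fix P :: "omega1 \<Rightarrow> bool" and a
  assume "\<And>x. (\<And>y. y < x \<Longrightarrow> P y) \<Longrightarrow> P x"
  then show "P a" using wf_induct[OF wf_omega1, of P a] by auto
qed

lemma uncountable_omega1: "uncountable (UNIV :: omega1 set)"
proof
  assume "countable (UNIV :: omega1 set)"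
  then have "countable (Field (cardSuc natLeq))"
    by (metis countable_image type_definition.Rep_range type_definition_omega1)
  then have "|Field (cardSuc natLeq)| \<le>o natLeq"
    by (simp add: countable_card_le_natLeq)
  moreover have "|Field (cardSuc natLeq)| =o cardSuc natLeq"
    using cardSuc_Card_order[OF natLeq_Card_order] card_of_Field_ordIso by blast
  ultimately show False
    using cardSuc_greater[OF natLeq_Card_order] not_ordLess_ordLeq ordIso_ordLeq_trans
      ordIso_symmetric by metis
qed

lemma countable_lessThan_omega1: "countable {..<x :: omega1}"
proof -
  let ?r = "cardSuc natLeq"
  have "|underS ?r (Rep_omega1 x)| <o ?r"
    using card_of_underS[OF cardSuc_Card_order[OF natLeq_Card_order] Rep_omega1] .
  then have "countable (underS ?r (Rep_omega1 x))"
    by (simp add: countable_card_le_natLeq cardSuc_ordLeq_ordLess natLeq_Card_order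
        card_of_Card_order)
  moreover have "Rep_omega1 ` {..<x} \<subseteq> underS ?r (Rep_omega1 x)"
    by (auto simp: underS_def less_omega1_def less_eq_omega1_def Rep_omega1_inject)
  ultimately have "countable (Rep_omega1 ` {..<x})"
    by (rule countable_subset[rotated])
  then show ?thesis
    by (rule countable_image_inj_on) (simp add: inj_on_def Rep_omega1_inject)
qed

lemma bounded_omega1:
  assumes "countable A"
  shows "\<exists>b :: omega1. \<forall>a\<in>A. a < b"
proof (rule ccontr)
  assume "\<not> ?thesis"
  then have "\<forall>b. \<exists>a\<in>A. b \<le> a" by (meson not_less)
  then have "UNIV \<subseteq> (\<Union>a\<in>A. insert a {..<a})" by (force simp: le_less)
  moreover have "countable (\<Union>a\<in>A. insert a {..<a})"
    using assms countable_lessThan_omega1 by auto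
  ultimately show False using uncountable_omega1 countable_subset by blast
qed

text \<open>Ordinal addition and multiplication by their usual transfinite recursions, as least strict
  (respectively weak) upper bounds of the earlier values.  The minima exist because countable
  subsets of \<open>\<omega>\<^sub>1\<close> are bounded.\<close>

instantiation omega1 :: "{zero, plus, times}"
begin

definition zero_omega1 :: omega1 where "0 = (LEAST x :: omega1. True)"

function plus_omega1 :: "omega1 \<Rightarrow> omega1 \<Rightarrow> omega1" where
  "plus_omega1 \<alpha> \<beta> = (LEAST \<delta>. \<alpha> \<le> \<delta> \<and> (\<forall>\<gamma>. \<gamma> < \<beta> \<longrightarrow> plus_omega1 \<alpha> \<gamma> < \<delta>))"
  by auto
termination
  by (relation "inv_image {(x, y :: omega1). x < y} snd") (simp_all add: wf_omega1)

declare plus_omega1.simps [simp del]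

function times_omega1 :: "omega1 \<Rightarrow> omega1 \<Rightarrow> omega1" where
  "times_omega1 \<alpha> \<beta> = (LEAST \<delta>. \<forall>\<gamma>. \<gamma> < \<beta> \<longrightarrow> times_omega1 \<alpha> \<gamma> + \<alpha> \<le> \<delta>)"
  by auto
termination
  by (relation "inv_image {(x, y :: omega1). x < y} snd") (simp_all add: wf_omega1)

instance ..

end

declare times_omega1.simps [simp del]

definition succ1 :: "omega1 \<Rightarrow> omega1"
  where "succ1 \<alpha> = (LEAST \<beta>. \<alpha> < \<beta>)"

primrec ord_of_nat :: "nat \<Rightarrow> omega1" where
  "ord_of_nat 0 = 0"
| "ord_of_nat (Suc n) = succ1 (ord_of_nat n)"

definition omega :: omega1
  where "omega = (LEAST \<beta>. \<forall>n. ord_of_nat n < \<beta>)"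

lemma zero_le_omega1 [simp]: "0 \<le> (\<alpha> :: omega1)"
  by (simp add: zero_omega1_def Least_le)

lemma less_succ1: "\<alpha> < succ1 \<alpha>"
  unfolding succ1_def using bounded_omega1[of "{\<alpha>}"] by (auto intro: LeastI)

lemma less_succ1_iff: "\<gamma> < succ1 \<alpha> \<longleftrightarrow> \<gamma> \<le> \<alpha>"
  by (metis Least_le less_succ1 not_less order.strict_trans1 succ1_def)

lemma ord_of_nat_less_omega: "ord_of_nat n < omega"
proof -
  obtain b where "\<forall>n. ord_of_nat n < b"
    using bounded_omega1[of "range ord_of_nat"] by auto
  then have "\<forall>n. ord_of_nat n < omega"
    unfolding omega_def by (rule LeastI)
  then show ?thesis ..
qed

lemma less_omega_iff: "\<gamma> < omega \<longleftrightarrow> (\<exists>n. \<gamma> = ord_of_nat n)"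
proof
  assume "\<gamma> < omega"
  then have "\<exists>n. \<gamma> \<le> ord_of_nat n"
    unfolding omega_def by (drule_tac not_less_Least) (simp add: not_less)
  then obtain n where "\<gamma> \<le> ord_of_nat n" ..
  then show "\<exists>n. \<gamma> = ord_of_nat n"
  proof (induction n)
    case 0
    then show ?case by (metis antisym zero_le_omega1 ord_of_nat.simps(1))
  next
    case (Suc n)
    then show ?case by (metis le_less less_succ1_iff ord_of_nat.simps(2))
  qed
qed (auto simp: ord_of_nat_less_omega)

lemma plus_omega1_le_iff:
  "(\<alpha> :: omega1) + \<beta> \<le> \<delta> \<longleftrightarrow> \<alpha> \<le> \<delta> \<and> (\<forall>\<gamma><\<beta>. \<alpha> + \<gamma> < \<delta>)"
proof -
  let ?P = "\<lambda>\<delta>. \<alpha> \<le> \<delta> \<and> (\<forall>\<gamma>. \<gamma> < \<beta> \<longrightarrow> \<alpha> + \<gamma> < \<delta>)"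
  have "countable (insert \<alpha> ((+) \<alpha> ` {..<\<beta>}))"
    using countable_lessThan_omega1 by auto
  from bounded_omega1[OF this] obtain b where "?P b" by (auto intro: less_imp_le)
  then have "?P (\<alpha> + \<beta>)" unfolding plus_omega1.simps[of \<alpha> \<beta>] by (rule LeastI)
  moreover have "\<alpha> + \<beta> \<le> \<delta>" if "?P \<delta>"
    using that unfolding plus_omega1.simps[of \<alpha> \<beta>] by (rule Least_le)
  ultimately show ?thesis by (meson order.trans order.strict_trans2)
qed

lemma times_omega1_le_iff:
  "(\<alpha> :: omega1) * \<beta> \<le> \<delta> \<longleftrightarrow> (\<forall>\<gamma><\<beta>. \<alpha> * \<gamma> + \<alpha> \<le> \<delta>)"
proof -
  let ?P = "\<lambda>\<delta>. \<forall>\<gamma>. \<gamma> < \<beta> \<longrightarrow> \<alpha> * \<gamma> + \<alpha> \<le> \<delta>"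
  have "countable ((\<lambda>\<gamma>. \<alpha> * \<gamma> + \<alpha>) ` {..<\<beta>})"
    using countable_lessThan_omega1 by auto
  from bounded_omega1[OF this] obtain b where "?P b" by (auto intro: less_imp_le)
  then have "?P (\<alpha> * \<beta>)" unfolding times_omega1.simps[of \<alpha> \<beta>] by (rule LeastI)
  moreover have "\<alpha> * \<beta> \<le> \<delta>" if "?P \<delta>"
    using that unfolding times_omega1.simps[of \<alpha> \<beta>] by (rule Least_le)
  ultimately show ?thesis by (meson order.trans)
qed

lemma plus_omega1_0: "(\<alpha> :: omega1) + 0 = \<alpha>"
proof (rule antisym)
  show "\<alpha> + 0 \<le> \<alpha>" by (simp add: plus_omega1_le_iff leD)
  show "\<alpha> \<le> \<alpha> + 0" using plus_omega1_le_iff[of \<alpha> 0 "\<alpha> + 0"] by simp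
qed

lemma plus_omega1_mono_strict: "\<gamma> < \<beta> \<Longrightarrow> (\<alpha> :: omega1) + \<gamma> < \<alpha> + \<beta>"
  using plus_omega1_le_iff[of \<alpha> \<beta> "\<alpha> + \<beta>"] by auto

lemma plus_omega1_succ1: "(\<alpha> :: omega1) + succ1 \<beta> = succ1 (\<alpha> + \<beta>)"
proof (rule antisym)
  show "\<alpha> + succ1 \<beta> \<le> succ1 (\<alpha> + \<beta>)"
    unfolding plus_omega1_le_iff
    by (metis le_less less_succ1 less_succ1_iff order.trans plus_omega1_le_iff
        plus_omega1_mono_strict)
  show "succ1 (\<alpha> + \<beta>) \<le> \<alpha> + succ1 \<beta>"
    by (metis less_succ1 less_succ1_iff not_less plus_omega1_mono_strict)
qed

lemma times_omega1_0: "(\<alpha> :: omega1) * 0 = 0"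
  by (rule antisym) (auto simp: times_omega1_le_iff leD)

lemma times_omega1_succ1: "(\<alpha> :: omega1) * succ1 \<beta> = \<alpha> * \<beta> + \<alpha>"
proof (rule antisym)
  have "\<alpha> * \<gamma> + \<alpha> \<le> \<alpha> * \<beta> + \<alpha>" if "\<gamma> \<le> \<beta>" for \<gamma>
  proof (cases "\<gamma> = \<beta>")
    case False
    then have "\<alpha> * \<gamma> + \<alpha> \<le> \<alpha> * \<beta>"
      using that times_omega1_le_iff[of \<alpha> \<beta> "\<alpha> * \<beta>"] by auto
    then show ?thesis using plus_omega1_le_iff[of "\<alpha> * \<beta>" \<alpha> "\<alpha> * \<beta> + \<alpha>"] by auto
  qed simp
  then show "\<alpha> * succ1 \<beta> \<le> \<alpha> * \<beta> + \<alpha>"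
    by (auto simp: times_omega1_le_iff[of \<alpha> "succ1 \<beta>"] less_succ1_iff)
  show "\<alpha> * \<beta> + \<alpha> \<le> \<alpha> * succ1 \<beta>"
    using times_omega1_le_iff[of \<alpha> "succ1 \<beta>" "\<alpha> * succ1 \<beta>"] less_succ1 by auto
qed


section \<open>Trees\<close>

text \<open>A tree order \<open>T s t\<close> (read \<open>s \<prec> t\<close>) has the whole type as its underlying set.  Ordinals are
  represented by well-order relations, compared with \<open>=o\<close> and \<open><o\<close>; the height of \<open>t\<close> is the
  (reflexive) order induced on the set of predecessors of \<open>t\<close>.\<close>

definition preds :: "('a \<Rightarrow> 'a \<Rightarrow> bool) \<Rightarrow> 'a \<Rightarrow> 'a set"
  where "preds T t = {s. T s t}"

definition height :: "('a \<Rightarrow> 'a \<Rightarrow> bool) \<Rightarrow> 'a \<Rightarrow> 'a rel"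
  where "height T t = {(x, y). x \<in> preds T t \<and> y \<in> preds T t \<and> (x = y \<or> T x y)}"

definition is_tree :: "('a \<Rightarrow> 'a \<Rightarrow> bool) \<Rightarrow> bool"
  where "is_tree T \<longleftrightarrow> irreflp T \<and> transp T \<and> (\<forall>t. well_order_on (preds T t) (height T t))"

definition level :: "('a \<Rightarrow> 'a \<Rightarrow> bool) \<Rightarrow> 'b rel \<Rightarrow> 'a set"
  where "level T \<alpha> = {t. height T t =o \<alpha>}"

text \<open>\<open>tree_height T \<eta>\<close> says that \<open>\<eta>\<close> is (up to isomorphism) the least ordinal whose level is empty.
  Ordinals below \<open>\<eta>\<close> are isomorphic to initial segments of \<open>\<eta>\<close>, so relations on the type of \<open>\<eta>\<close>
  represent all of them.\<close>

definition tree_height :: "('a \<Rightarrow> 'a \<Rightarrow> bool) \<Rightarrow> 'b rel \<Rightarrow> bool"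
  where "tree_height T \<eta> \<longleftrightarrow>
    Well_order \<eta> \<and> level T \<eta> = {} \<and> (\<forall>\<alpha> :: 'b rel. \<alpha> <o \<eta> \<longrightarrow> level T \<alpha> \<noteq> {})"

definition ord_omega1 :: "omega1 rel"
  where "ord_omega1 = {(x, y). x \<le> y}"

definition ord_below :: "omega1 \<Rightarrow> omega1 rel"
  where "ord_below \<alpha> = {(x, y). x \<le> y \<and> y < \<alpha>}"

text \<open>Every nonempty level of a tree on \<open>'a\<close> is represented by some \<open>\<alpha> :: 'a rel\<close>, and so is the
  height of the tree, since choosing a node in each level embeds it into \<open>'a\<close>.\<close>

definition omega1_tree :: "('a \<Rightarrow> 'a \<Rightarrow> bool) \<Rightarrow> bool"
  where "omega1_tree T \<longleftrightarrow>
    is_tree T \<and> tree_height T ord_omega1 \<and> (\<forall>\<alpha> :: 'a rel. countable (level T \<alpha>))"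

definition normal_tree :: "('a \<Rightarrow> 'a \<Rightarrow> bool) \<Rightarrow> bool"
  where "normal_tree T \<longleftrightarrow>
    (\<forall>(\<eta> :: 'a rel) (\<alpha> :: 'a rel) s. tree_height T \<eta> \<longrightarrow> height T s <o \<alpha> \<longrightarrow> \<alpha> <o \<eta> \<longrightarrow>
      (\<exists>t \<in> level T \<alpha>. T s t))"

definition immediate_succs :: "('a \<Rightarrow> 'a \<Rightarrow> bool) \<Rightarrow> 'a \<Rightarrow> 'a set"
  where "immediate_succs T s = {t. T s t \<and> \<not> (\<exists>u. T s u \<and> T u t)}"

definition omega_splitting :: "('a \<Rightarrow> 'a \<Rightarrow> bool) \<Rightarrow> bool"
  where "omega_splitting T \<longleftrightarrow> (\<forall>s. infinite (immediate_succs T s))"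

definition aronszajn :: "('a \<Rightarrow> 'a \<Rightarrow> bool) \<Rightarrow> bool"
  where "aronszajn T \<longleftrightarrow> omega1_tree T \<and>
    (\<forall>A. (\<forall>x\<in>A. \<forall>y\<in>A. x = y \<or> T x y \<or> T y x) \<longrightarrow> countable A)"


section \<open>Topological groups\<close>

definition topological_group :: "('g, 'm) monoid_scheme \<Rightarrow> 'g topology \<Rightarrow> bool"
  where "topological_group G X \<longleftrightarrow> group G \<and> topspace X = carrier G \<and>
    continuous_map (prod_topology X X) X (\<lambda>(x, y). x \<otimes>\<^bsub>G\<^esub> y) \<and>
    continuous_map X X (\<lambda>x. inv\<^bsub>G\<^esub> x)"

definition open_nbhd_base :: "'g topology \<Rightarrow> 'g \<Rightarrow> 'g set set \<Rightarrow> bool"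
  where "open_nbhd_base X x \<B> \<longleftrightarrow>
    (\<forall>B\<in>\<B>. openin X B \<and> x \<in> B) \<and> (\<forall>U. openin X U \<and> x \<in> U \<longrightarrow> (\<exists>B\<in>\<B>. B \<subseteq> U))"

definition frechet_group :: "('g, 'm) monoid_scheme \<Rightarrow> 'g topology \<Rightarrow> bool"
  where "frechet_group G X \<longleftrightarrow>
    (\<forall>A \<subseteq> carrier G. \<one>\<^bsub>G\<^esub> \<in> X closure_of A \<longrightarrow>
      (\<exists>\<sigma> :: nat \<Rightarrow> 'g. range \<sigma> \<subseteq> A \<and> limitin X \<sigma> \<one>\<^bsub>G\<^esub> sequentially))"

definition finset_group :: "'a set monoid"
  where "finset_group = \<lparr>carrier = {a. finite a}, mult = (\<lambda>a b. sym_diff a b), one = {}\<rparr>"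

definition avoiding :: "'a set \<Rightarrow> 'a set set"
  where "avoiding F = {a. finite a \<and> a \<inter> F = {}}"

text \<open>The topology of \<open>G(\<F>)\<close>.  It exists and is unique as soon as \<open>\<F>\<close> is nonempty and directed under
  inclusion (lemma \<open>ex1_G_topology\<close>); the family \<open>F_family T\<close> of a normal \<open>\<omega>\<^sub>1\<close>-tree with levels
  \<open>[\<omega>\<alpha>, \<omega>\<alpha> + \<omega>)\<close> is, since every node has an extension at each higher level.\<close>

definition G_topology :: "'a set set \<Rightarrow> 'a set topology"
  where "G_topology \<F> = (THE X. topological_group finset_group X \<and>
    open_nbhd_base X \<one>\<^bsub>finset_group\<^esub> (avoiding ` \<F>))"

lemma finset_group_simps [simp]:
  "carrier finset_group = {a. finite a}"
  "a \<otimes>\<^bsub>finset_group\<^esub> b = sym_diff a b"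
  "\<one>\<^bsub>finset_group\<^esub> = {}"
  by (simp_all add: finset_group_def)

lemma group_finset_group: "group finset_group"
proof (rule groupI)
  fix x :: "'a set" assume "x \<in> carrier finset_group"
  then show "\<exists>y\<in>carrier finset_group. y \<otimes>\<^bsub>finset_group\<^esub> x = \<one>\<^bsub>finset_group\<^esub>"
    by (intro bexI[of _ x]) auto
qed auto

lemma inv_finset_group:
  assumes "finite a"
  shows "inv\<^bsub>finset_group\<^esub> a = a"
  using group.inv_equality[OF group_finset_group, of a a] assms by auto

definition avoiding_coset :: "'a set \<Rightarrow> 'a set \<Rightarrow> 'a set set"
  where "avoiding_coset a F = {b. finite b \<and> sym_diff a b \<inter> F = {}}"

lemma avoiding_coset_eq:
  assumes "b \<in> avoiding_coset a F"
  shows "avoiding_coset b F = avoiding_coset a F"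
proof -
  have "sym_diff a b \<inter> F = {}" using assms by (simp add: avoiding_coset_def)
  then have "sym_diff b c \<inter> F = sym_diff a c \<inter> F" for c by blast
  then show ?thesis by (simp add: avoiding_coset_def)
qed

lemma avoiding_coset_self: "finite a \<Longrightarrow> a \<in> avoiding_coset a F"
  by (simp add: avoiding_coset_def)

lemma avoiding_coset_empty: "avoiding_coset {} F = avoiding F"
  by (auto simp: avoiding_coset_def avoiding_def)

lemma avoiding_coset_mono: "E \<subseteq> F \<Longrightarrow> avoiding_coset a F \<subseteq> avoiding_coset a E"
  by (auto simp: avoiding_coset_def)

lemma avoiding_coset_mult:
  assumes "v \<in> avoiding_coset x F" "w \<in> avoiding_coset y F"
  shows "sym_diff v w \<in> avoiding_coset (sym_diff x y) F"
proof -
  have "z \<notin> sym_diff (sym_diff x y) (sym_diff v w)" if "z \<in> F" for z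
    using assms that by (auto simp: avoiding_coset_def)
  then have "sym_diff (sym_diff x y) (sym_diff v w) \<inter> F = {}" by blast
  moreover have "finite (sym_diff v w)" using assms by (simp add: avoiding_coset_def)
  ultimately show ?thesis unfolding avoiding_coset_def by blast
qed

lemma topological_group_openin_iff:
  fixes X :: "'a set topology"
  assumes X: "topological_group finset_group X" "open_nbhd_base X {} (avoiding ` \<F>)"
  shows "openin X U \<longleftrightarrow> (\<forall>a\<in>U. finite a \<and> (\<exists>F\<in>\<F>. avoiding_coset a F \<subseteq> U))"
proof -
  have top: "topspace X = {a. finite a}"
    using X(1) by (simp add: topological_group_def)
  have mult: "continuous_map (prod_topology X X) X (\<lambda>(x, y). sym_diff x y)"
    using X(1) by (simp add: topological_group_def)
  have trans: "continuous_map X X (\<lambda>b. sym_diff a b)" if "finite a" for a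
  proof -
    have "continuous_map X (prod_topology X X) (\<lambda>b. (a, b))"
      using that top by (auto simp: continuous_map_pairwise o_def)
    from continuous_map_compose[OF this mult] show ?thesis by (simp add: o_def)
  qed
  have op: "openin X {b \<in> topspace X. sym_diff a b \<in> V}" if "finite a" "openin X V" for a V
    using trans[OF that(1)] that(2) by (simp add: continuous_map_def)
  have inv: "sym_diff a (sym_diff a b) = b" for a b :: "'a set" by auto
  have coset: "avoiding_coset a F = {b \<in> topspace X. sym_diff a b \<in> avoiding F}"
    if "finite a" for a F
    using that by (auto simp: avoiding_coset_def avoiding_def top)
  show ?thesis
  proof (intro iffI ballI conjI)
    fix a assume U: "openin X U" and a: "a \<in> U"
    show fin: "finite a" using openin_subset[OF U] a top by auto
    have "openin X {b \<in> topspace X. sym_diff a b \<in> U}" using op[OF fin U] .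
    moreover have "{} \<in> {b \<in> topspace X. sym_diff a b \<in> U}" using a top by simp
    ultimately obtain F where F: "F \<in> \<F>" "avoiding F \<subseteq> {b \<in> topspace X. sym_diff a b \<in> U}"
      using X(2) unfolding open_nbhd_base_def by blast
    have "avoiding_coset a F \<subseteq> U"
    proof
      fix b assume "b \<in> avoiding_coset a F"
      then have "sym_diff a b \<in> avoiding F" by (simp add: coset[OF fin])
      then have "sym_diff a (sym_diff a b) \<in> U" using F(2) by blast
      then show "b \<in> U" by (simp only: inv)
    qed
    then show "\<exists>F\<in>\<F>. avoiding_coset a F \<subseteq> U" using F(1) by blast
  next
    assume *: "\<forall>a\<in>U. finite a \<and> (\<exists>F\<in>\<F>. avoiding_coset a F \<subseteq> U)"
    show "openin X U"
    proof (subst openin_subopen, intro ballI)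
      fix a assume a: "a \<in> U"
      then obtain F where F: "F \<in> \<F>" "avoiding_coset a F \<subseteq> U" and fin: "finite a"
        using * by auto
      have "openin X (avoiding F)" using X(2) F(1) by (simp add: open_nbhd_base_def)
      then have "openin X (avoiding_coset a F)" unfolding coset[OF fin] by (rule op[OF fin])
      then show "\<exists>V. openin X V \<and> a \<in> V \<and> V \<subseteq> U"
        using F(2) avoiding_coset_self[OF fin] by auto
    qed
  qed
qed

lemma ex1_G_topology:
  fixes \<F> :: "'a set set"
  assumes ne: "\<F> \<noteq> {}"
    and dir: "\<And>E F. E \<in> \<F> \<Longrightarrow> F \<in> \<F> \<Longrightarrow> \<exists>H\<in>\<F>. E \<union> F \<subseteq> H"
  shows "\<exists>!X. topological_group finset_group X \<and>
    open_nbhd_base X \<one>\<^bsub>finset_group\<^esub> (avoiding ` \<F>)"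
proof (rule ex_ex1I)
  define P where "P U \<longleftrightarrow> (\<forall>a\<in>U. finite a \<and> (\<exists>F\<in>\<F>. avoiding_coset a F \<subseteq> U))"
    for U :: "'a set set"
  define X where "X = topology P"
  have "istopology P"
    unfolding istopology_def
  proof (intro conjI allI impI)
    fix S U assume S: "P S" and U: "P U"
    show "P (S \<inter> U)"
      unfolding P_def
    proof (intro ballI conjI)
      fix a assume a: "a \<in> S \<inter> U"
      show "finite a" using a S by (simp add: P_def)
      obtain E where E: "E \<in> \<F>" "avoiding_coset a E \<subseteq> S" using S a unfolding P_def by blast
      obtain F where F: "F \<in> \<F>" "avoiding_coset a F \<subseteq> U" using U a unfolding P_def by blast
      obtain H where H: "H \<in> \<F>" "E \<union> F \<subseteq> H" using dir[OF E(1) F(1)] by blast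
      have "avoiding_coset a H \<subseteq> S \<inter> U"
        using avoiding_coset_mono[of E H a] avoiding_coset_mono[of F H a] E(2) F(2) H(2) by auto
      then show "\<exists>F\<in>\<F>. avoiding_coset a F \<subseteq> S \<inter> U" using H(1) by blast
    qed
  next
    fix K assume K: "\<forall>U\<in>K. P U"
    show "P (\<Union>K)"
      unfolding P_def
    proof (intro ballI conjI)
      fix a assume "a \<in> \<Union>K"
      then obtain U where U: "U \<in> K" "a \<in> U" by blast
      then have PU: "P U" using K by blast
      show "finite a" using PU U(2) by (simp add: P_def)
      obtain F where "F \<in> \<F>" "avoiding_coset a F \<subseteq> U" using PU U(2) unfolding P_def by blast
      then show "\<exists>F\<in>\<F>. avoiding_coset a F \<subseteq> \<Union>K" using U(1) by blast
    qed
  qed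
  then have op: "openin X U \<longleftrightarrow> P U" for U by (simp add: X_def topology_inverse')
  have "P {a. finite a}" using ne by (auto simp: P_def avoiding_coset_def)
  then have "{a. finite a} \<subseteq> topspace X" using openin_subset op by blast
  moreover have "finite a" if "a \<in> topspace X" for a
    using that openin_topspace[of X] unfolding op P_def by blast
  ultimately have top: "topspace X = {a. finite a}" by blast
  have coset: "openin X (avoiding_coset a F)" if "F \<in> \<F>" for a F
    unfolding op P_def
  proof (intro ballI conjI)
    fix b assume b: "b \<in> avoiding_coset a F"
    then show "finite b" by (simp add: avoiding_coset_def)
    show "\<exists>F'\<in>\<F>. avoiding_coset b F' \<subseteq> avoiding_coset a F"
      using that avoiding_coset_eq[OF b] by auto
  qed
  have "continuous_map (prod_topology X X) X (\<lambda>(x, y). sym_diff x y)"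
    unfolding continuous_map_def
  proof (intro conjI allI impI)
    show "(\<lambda>(x, y). sym_diff x y) \<in> topspace (prod_topology X X) \<rightarrow> topspace X"
      by (auto simp: top)
    fix U assume "openin X U"
    then have U: "P U" by (simp add: op)
    let ?Z = "{z \<in> topspace (prod_topology X X). (\<lambda>(x, y). sym_diff x y) z \<in> U}"
    show "openin (prod_topology X X) ?Z"
      unfolding openin_prod_topology_alt
    proof (intro allI impI)
      fix x y
      assume "(x, y) \<in> ?Z"
      then have fin: "finite x" "finite y" and xy: "sym_diff x y \<in> U"
        by (simp_all add: top)
      obtain F where F: "F \<in> \<F>" "avoiding_coset (sym_diff x y) F \<subseteq> U"
        using U xy unfolding P_def by meson
      have "avoiding_coset x F \<times> avoiding_coset y F \<subseteq> ?Z"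
      proof (rule subsetI, clarify)
        fix v w assume vw: "v \<in> avoiding_coset x F" "w \<in> avoiding_coset y F"
        have "sym_diff v w \<in> U" using avoiding_coset_mult[OF vw] F(2) by (rule rev_subsetD)
        moreover have "finite v" "finite w" using vw by (simp_all add: avoiding_coset_def)
        ultimately show "(v, w) \<in> topspace (prod_topology X X) \<and> sym_diff v w \<in> U"
          by (simp add: top)
      qed
      then show "\<exists>V W. openin X V \<and> openin X W \<and> x \<in> V \<and> y \<in> W \<and> V \<times> W \<subseteq> ?Z"
        by (intro exI[of _ "avoiding_coset x F"] exI[of _ "avoiding_coset y F"])
          (simp add: coset[OF F(1)] avoiding_coset_self fin)
    qed
  qed
  moreover have "continuous_map X X (\<lambda>x. inv\<^bsub>finset_group\<^esub> x)"
    by (rule continuous_map_eq[OF continuous_map_id]) (simp add: top inv_finset_group)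
  ultimately have "topological_group finset_group X"
    by (simp add: topological_group_def group_finset_group top)
  moreover have "open_nbhd_base X {} (avoiding ` \<F>)"
    unfolding open_nbhd_base_def
  proof (intro conjI ballI allI impI)
    fix B assume "B \<in> avoiding ` \<F>"
    then obtain F where F: "F \<in> \<F>" "B = avoiding F" by blast
    then show "openin X B" using coset[OF F(1), of "{}"] by (simp add: avoiding_coset_empty)
    show "{} \<in> B" using F(2) by (simp add: avoiding_def)
  next
    fix U assume "openin X U \<and> {} \<in> U"
    then have "P U" "{} \<in> U" by (simp_all add: op)
    then obtain F where "F \<in> \<F>" "avoiding_coset {} F \<subseteq> U"
      unfolding P_def by blast
    then show "\<exists>B\<in>avoiding ` \<F>. B \<subseteq> U" by (auto simp: avoiding_coset_empty)
  qed
  ultimately show "\<exists>X. topological_group finset_group X \<and>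
      open_nbhd_base X \<one>\<^bsub>finset_group\<^esub> (avoiding ` \<F>)"
    by (intro exI[of _ X]) simp
next
  fix X Y
  assume "topological_group finset_group X \<and> open_nbhd_base X \<one>\<^bsub>finset_group\<^esub> (avoiding ` \<F>)"
    and "topological_group finset_group Y \<and> open_nbhd_base Y \<one>\<^bsub>finset_group\<^esub> (avoiding ` \<F>)"
  then have X: "topological_group finset_group X" "open_nbhd_base X {} (avoiding ` \<F>)"
    and Y: "topological_group finset_group Y" "open_nbhd_base Y {} (avoiding ` \<F>)"
    by simp_all
  show "X = Y"
    unfolding topology_eq topological_group_openin_iff[OF X] topological_group_openin_iff[OF Y]
    by simp
qed


section \<open>The family of a tree on \<open>\<omega>\<^sub>1\<close>\<close>

definition omega_fixpoints :: "omega1 set"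
  where "omega_fixpoints = {\<alpha>. omega * \<alpha> = \<alpha>}"

definition F_set :: "(omega1 \<Rightarrow> omega1 \<Rightarrow> bool) \<Rightarrow> nat \<Rightarrow> omega1 \<Rightarrow> omega1 set"
  where "F_set T n \<alpha> = {\<gamma>. \<gamma> < \<alpha> \<and> (\<exists>m\<le>n. T \<gamma> (\<alpha> + ord_of_nat m))}"

definition F_family :: "(omega1 \<Rightarrow> omega1 \<Rightarrow> bool) \<Rightarrow> omega1 set set"
  where "F_family T = {F_set T n \<alpha> | n \<alpha>. \<alpha> \<in> omega_fixpoints}"

end

theory Submission
  imports Defs
begin

text \<open>An uncountable chain \<open>B\<close> yields the set of singletons \<open>{x}\<close>, \<open>x \<in> B\<close>: it accumulates at
  \<open>\<emptyset>\<close> because \<open>B\<close> is unbounded, but every sequence in \<open>B\<close> lies on the branch below a single node.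

  Conversely, let all chains be countable and \<open>\<emptyset>\<close> be in the closure of \<open>A\<close>.  It suffices to find a
  fixed point \<open>\<delta>\<close> such that every \<open>F_set T n \<delta>\<close> is avoided by some \<open>a\<^sub>n \<in> A\<close> with \<open>a\<^sub>n \<subseteq> \<delta>\<close>: the
  trace on \<open>\<delta>\<close> of any member of the family is contained in some \<open>F_set T j \<delta>\<close>, so \<open>a\<^sub>n\<close> converges to
  \<open>\<emptyset>\<close>.  Such a \<open>\<delta>\<close> exists by pressing down and Baumgartner's ultrafilter argument for Aronszajn
  trees.\<close>

section \<open>Ordinal arithmetic below \<open>\<omega>\<^sub>1\<close>\<close>

lemma omega1_unbounded_iff: "uncountable S \<longleftrightarrow> (\<forall>\<beta> :: omega1. \<exists>x\<in>S. \<beta> < x)"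
proof
  assume S: "uncountable S"
  show "\<forall>\<beta>. \<exists>x\<in>S. \<beta> < x"
  proof (rule ccontr)
    assume "\<not> ?thesis"
    then obtain \<beta> where "S \<subseteq> {..<succ1 \<beta>}"
      by (force simp: less_succ1_iff not_less)
    then show False
      using S countable_lessThan_omega1 countable_subset by blast
  qed
next
  assume "\<forall>\<beta>. \<exists>x\<in>S. \<beta> < x"
  then show "uncountable S" using bounded_omega1 order.asym by metis
qed

lemma less_plus_omega: "\<alpha> < \<alpha> + omega"
  using plus_omega1_mono_strict[OF ord_of_nat_less_omega[of 0], of \<alpha>] by (simp add: plus_omega1_0)

lemma times_plus_le: "\<gamma> < \<beta> \<Longrightarrow> (\<alpha> :: omega1) * \<gamma> + \<alpha> \<le> \<alpha> * \<beta>"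
  using times_omega1_le_iff[of \<alpha> \<beta> "\<alpha> * \<beta>"] by simp

text \<open>If \<open>\<alpha>\<close> were moved down, the induction hypothesis at
  \<open>omega * \<alpha>\<close> would give a value at least \<open>omega * \<alpha>\<close>, while
  the block of that index ends by \<open>omega * \<alpha>\<close>.\<close>

lemma le_omega_times: "\<alpha> \<le> omega * \<alpha>"
proof (induction \<alpha> rule: less_induct)
  case (less \<alpha>)
  show ?case
  proof (rule ccontr)
    assume "\<not> ?case"
    then have lt: "omega * \<alpha> < \<alpha>" by simp
    have "omega * \<alpha> \<le> omega * (omega * \<alpha>)" by (rule less.IH[OF lt])
    also have "\<dots> < omega * (omega * \<alpha>) + omega" by (rule less_plus_omega)
    also have "\<dots> \<le> omega * \<alpha>" by (rule times_plus_le[OF lt])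
    finally show False by simp
  qed
qed

lemma omega_times_mono: "\<alpha> \<le> \<beta> \<Longrightarrow> omega * \<alpha> \<le> omega * \<beta>"
  by (metis le_less less_plus_omega order.strict_implies_order order.trans times_plus_le)

lemma omega_block_unique:
  assumes "omega * \<alpha> \<le> x" "x < omega * \<alpha> + omega" "omega * \<beta> \<le> x" "x < omega * \<beta> + omega"
  shows "\<alpha> = \<beta>"
  using assms by (meson linorder_neq_iff not_less order.trans times_plus_le order.strict_trans2)

lemma omega_block_exists: "\<exists>\<alpha>. omega * \<alpha> \<le> x \<and> x < omega * \<alpha> + omega"
proof -
  let ?\<alpha> = "LEAST \<alpha>. x < omega * \<alpha> + omega"
  have "x < omega * x + omega"
    using le_omega_times less_plus_omega order.strict_trans1 by blast
  then have 1: "x < omega * ?\<alpha> + omega" by (rule LeastI)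
  \<comment> \<open>By minimality every earlier block ends at or below \<open>x\<close>, and
    \<open>omega * ?\<alpha>\<close> is the least upper bound of those ends.\<close>
  have "omega * \<gamma> + omega \<le> x" if "\<gamma> < ?\<alpha>" for \<gamma>
    using not_less_Least[OF that] by simp
  then have "omega * ?\<alpha> \<le> x" by (simp add: times_omega1_le_iff)
  with 1 show ?thesis by blast
qed

lemma plus_omega_block:
  assumes "\<alpha> \<le> \<gamma>" "\<gamma> < \<alpha> + omega"
  shows "\<exists>m. \<gamma> = \<alpha> + ord_of_nat m"
proof -
  obtain k where "\<gamma> \<le> \<alpha> + ord_of_nat k"
    using assms plus_omega1_le_iff[of \<alpha> omega \<gamma>] less_omega_iff not_le by metis
  then show ?thesis
  proof (induction k)
    case 0
    then show ?case using assms(1) by (metis antisym ord_of_nat.simps(1) plus_omega1_0)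
  next
    case (Suc k)
    then show ?case
      by (metis le_less less_succ1_iff ord_of_nat.simps(2) plus_omega1_succ1)
  qed
qed

lemma plus_ord_of_nat_bounds: "\<alpha> \<le> \<alpha> + ord_of_nat m" "\<alpha> + ord_of_nat m < \<alpha> + omega"
  using plus_omega1_le_iff[of \<alpha> "ord_of_nat m" "\<alpha> + ord_of_nat m"]
  by (auto intro: plus_omega1_mono_strict ord_of_nat_less_omega)

section \<open>Closure points among the fixed points, and pressing down\<close>

text \<open>\<open>\<delta>\<close> is the supremum of the iterates of a function \<open>g\<close>
  that outgrows \<open>x\<close>, \<open>omega * x\<close> and the values of \<open>h\<close> up to
  \<open>x\<close>. A finite subset of \<open>\<delta>\<close> is already bounded by one
  iterate.\<close>

lemma omega_fixpoints_closed_under: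
  fixes h :: "omega1 \<Rightarrow> omega1"
  shows "\<exists>\<delta>\<in>omega_fixpoints. \<beta> < \<delta> \<and> (\<forall>\<gamma><\<delta>. h \<gamma> < \<delta>) \<and>
    (\<forall>r. finite r \<longrightarrow> r \<subseteq> {..<\<delta>} \<longrightarrow> (\<exists>\<gamma><\<delta>. r \<subseteq> {..<\<gamma>}))"
proof -
  have "\<exists>b. x < b \<and> omega * x < b \<and> (\<forall>\<gamma>\<le>x. h \<gamma> < b)" for x
  proof -
    have "countable ({x, omega * x} \<union> h ` {..<succ1 x})"
      by (simp add: countable_lessThan_omega1)
    from bounded_omega1[OF this] show ?thesis by (auto simp: less_succ1_iff)
  qed
  then obtain g where "\<forall>x. x < g x \<and> omega * x < g x \<and> (\<forall>\<gamma>\<le>x. h \<gamma> < g x)"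
    using choice[of "\<lambda>x b. x < b \<and> omega * x < b \<and> (\<forall>\<gamma>\<le>x. h \<gamma> < b)"] by blast
  then have g: "\<And>x. x < g x" "\<And>x. omega * x < g x" "\<And>x \<gamma>. \<gamma> \<le> x \<Longrightarrow> h \<gamma> < g x"
    by simp_all
  define d where "d k = (g ^^ k) \<beta>" for k
  have d_Suc: "d (Suc k) = g (d k)" and d_0: "d 0 = \<beta>" for k by (simp_all add: d_def)
  have d_mono: "d i \<le> d j" if "i \<le> j" for i j
    using _ that
  proof (rule lift_Suc_mono_le)
    show "d k \<le> d (Suc k)" for k unfolding d_Suc by (intro less_imp_le g(1))
  qed
  define \<delta> where "\<delta> = (LEAST \<delta>. \<forall>k. d k < \<delta>)"
  have "\<exists>b. \<forall>k. d k < b" using bounded_omega1[of "range d"] by auto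
  then have "\<forall>k. d k < \<delta>" unfolding \<delta>_def by (rule LeastI_ex)
  then have d_less: "d k < \<delta>" for k by blast
  have below: "\<exists>k. \<gamma> \<le> d k" if "\<gamma> < \<delta>" for \<gamma>
    using not_less_Least[OF that[unfolded \<delta>_def]] by (auto simp: not_less)
  have "omega * \<gamma> + omega \<le> \<delta>" if \<gamma>: "\<gamma> < \<delta>" for \<gamma>
  proof -
    obtain k where "\<gamma> \<le> d k" using below \<gamma> by blast
    \<comment> \<open>One more iterate makes the bound strict, so that the whole block of index
      \<open>\<gamma>\<close> ends by \<open>omega * d (Suc k)\<close>.\<close>
    also have "d k < d (Suc k)" unfolding d_Suc by (rule g(1))
    finally have "\<gamma> < d (Suc k)" .
    then have "omega * \<gamma> + omega \<le> omega * d (Suc k)" by (rule times_plus_le)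
    also have "\<dots> \<le> d (Suc (Suc k))" unfolding d_Suc[of "Suc k"] by (intro less_imp_le g(2))
    also have "\<dots> \<le> \<delta>" using d_less by (rule less_imp_le)
    finally show ?thesis .
  qed
  then have "omega * \<delta> \<le> \<delta>" by (simp add: times_omega1_le_iff)
  then have fix\<delta>: "\<delta> \<in> omega_fixpoints"
    using le_omega_times[of \<delta>] by (simp add: omega_fixpoints_def)
  moreover have "h \<gamma> < \<delta>" if \<gamma>: "\<gamma> < \<delta>" for \<gamma>
  proof -
    obtain k where "\<gamma> \<le> d k" using below \<gamma> by blast
    then have "h \<gamma> < d (Suc k)" unfolding d_Suc by (rule g(3))
    also have "\<dots> < \<delta>" by (rule d_less)
    finally show ?thesis .
  qed
  moreover have "\<exists>\<gamma><\<delta>. r \<subseteq> {..<\<gamma>}" if r: "finite r" "r \<subseteq> {..<\<delta>}" for r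
  proof -
    have "\<exists>k. \<forall>x\<in>r. x \<le> d k"
      using r
    proof (induction r)
      case (insert x r)
      obtain i where i: "\<forall>x\<in>r. x \<le> d i" using insert by auto
      obtain j where j: "x \<le> d j" using below insert.prems by auto
      have "d i \<le> d (max i j)" "d j \<le> d (max i j)" by (simp_all add: d_mono)
      then have "\<forall>y\<in>insert x r. y \<le> d (max i j)" using i j by (auto intro: order.trans)
      then show ?case by blast
    qed simp
    then obtain k where "\<forall>x\<in>r. x \<le> d k" by blast
    moreover have "d k < d (Suc k)" unfolding d_Suc by (rule g(1))
    ultimately have "r \<subseteq> {..<d (Suc k)}" by auto
    then show ?thesis using d_less by blast
  qed
  moreover have "\<beta> < \<delta>" using d_less[of 0] d_0 by simp
  ultimately show ?thesis by (intro bexI[of _ \<delta>]) simp_all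
qed

text \<open>The pressing-down lemma with finite sets as values: if all fibres were countable, some
  \<open>\<delta>\<close> would be closed under the function bounding them, which fails at \<open>\<delta>\<close> itself.\<close>

lemma pressing_down_finite:
  fixes f :: "omega1 \<Rightarrow> 'a :: countable" and R :: "omega1 \<Rightarrow> omega1 set"
  assumes R: "\<And>\<delta>. \<delta> \<in> omega_fixpoints \<Longrightarrow> finite (R \<delta>) \<and> R \<delta> \<subseteq> {..<\<delta>}"
  shows "\<exists>n r. uncountable {\<delta>\<in>omega_fixpoints. f \<delta> = n \<and> R \<delta> = r}"
proof (rule ccontr)
  assume "\<not> ?thesis"
  then have fib: "countable {\<delta>\<in>omega_fixpoints. f \<delta> = n \<and> R \<delta> = r}" for n r by simp
  have "\<exists>b. \<forall>\<delta>\<in>omega_fixpoints. R \<delta> \<subseteq> {..<\<gamma>} \<longrightarrow> \<delta> < b" for \<gamma>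
  proof -
    \<comment> \<open>Only countably many pairs of a value \<open>n\<close> and a finite
      \<open>r\<close> below \<open>\<gamma>\<close> exist, so countable fibres have a countable,
      hence bounded, union.\<close>
    let ?Z = "\<Union>n. \<Union>r\<in>{r. finite r \<and> r \<subseteq> {..<\<gamma>}}. {\<delta>\<in>omega_fixpoints. f \<delta> = n \<and> R \<delta> = r}"
    have "countable {r. finite r \<and> r \<subseteq> {..<\<gamma>}}"
      by (rule countable_Collect_finite_subset) (rule countable_lessThan_omega1)
    then have "countable ?Z" using fib by (intro countable_UN) auto
    from bounded_omega1[OF this] obtain b where b: "\<forall>\<delta>\<in>?Z. \<delta> < b" ..
    have "\<delta> \<in> ?Z" if "\<delta> \<in> omega_fixpoints" "R \<delta> \<subseteq> {..<\<gamma>}" for \<delta>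
      using R that by simp
    with b show ?thesis by blast
  qed
  then obtain h where h: "\<And>\<gamma> \<delta>. \<delta> \<in> omega_fixpoints \<Longrightarrow> R \<delta> \<subseteq> {..<\<gamma>} \<Longrightarrow> \<delta> < h \<gamma>"
    by metis
  obtain \<delta> where \<delta>: "\<delta> \<in> omega_fixpoints" "\<forall>\<gamma><\<delta>. h \<gamma> < \<delta>"
    "\<forall>r. finite r \<longrightarrow> r \<subseteq> {..<\<delta>} \<longrightarrow> (\<exists>\<gamma><\<delta>. r \<subseteq> {..<\<gamma>})"
    using omega_fixpoints_closed_under[of 0 h] by (elim bexE conjE)
  then obtain \<gamma> where "\<gamma> < \<delta>" "R \<delta> \<subseteq> {..<\<gamma>}" using R[OF \<delta>(1)] by blast
  then have "h \<gamma> < \<delta>" "\<delta> < h \<gamma>" using h \<delta> by blast+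
  then show False by (rule order.asym)
qed

section \<open>Ultrafilters\<close>

definition ultra :: "'a filter \<Rightarrow> bool"
  where "ultra U \<longleftrightarrow> U \<noteq> bot \<and> (\<forall>P. eventually P U \<or> eventually (\<lambda>x. \<not> P x) U)"

text \<open>If each alternative failed, \<open>U\<close> would decide all the negations, and hence
  their finite conjunction.\<close>

lemma ultra_bex_finite:
  assumes "ultra U" "finite I" "eventually (\<lambda>x. \<exists>i\<in>I. P i x) U"
  shows "\<exists>i\<in>I. eventually (P i) U"
proof (rule ccontr)
  assume "\<not> ?thesis"
  then have "\<forall>i\<in>I. eventually (\<lambda>x. \<not> P i x) U" using assms(1) by (auto simp: ultra_def)
  then have "eventually (\<lambda>x. \<forall>i\<in>I. \<not> P i x) U" using assms(2) by (simp add: eventually_ball_finite)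
  with assms(3) have "eventually (\<lambda>x. False) U" by eventually_elim blast
  then show False using assms(1) by (simp add: ultra_def)
qed

text \<open>Smaller filters are finer, so Zorn's lemma is applied to the reversed order and yields a
  minimal proper filter below \<open>F\<close>.\<close>

lemma ultra_exists:
  fixes F :: "'a filter"
  assumes "F \<noteq> bot"
  shows "\<exists>U\<le>F. ultra U"
proof -
  let ?A = "{G. G \<le> F \<and> G \<noteq> bot}"
  have "\<exists>U\<in>?A. \<forall>G\<in>?A. G \<le> U \<longrightarrow> G = U"
  proof (rule predicate_Zorn)
    show "partial_order_on ?A (relation_of (\<lambda>G H. H \<le> G) ?A)"
      by (rule partial_order_on_relation_ofI) auto
  next
    fix C assume C: "C \<in> Chains (relation_of (\<lambda>G H. H \<le> G) ?A)"
    have sub: "C \<subseteq> ?A" and chain: "\<And>G H. G \<in> C \<Longrightarrow> H \<in> C \<Longrightarrow> G \<le> H \<or> H \<le> G"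
      using C by (auto simp: Chains_def relation_of_def)
    show "\<exists>U\<in>?A. \<forall>G\<in>C. U \<le> G"
    proof (cases "C = {}")
      case True
      then show ?thesis using assms by auto
    next
      case False
      \<comment> \<open>A nonempty chain is a base of its infimum, so the infimum can be improper
        only if a member is.\<close>
      have "eventually (\<lambda>x. False) (Inf C) \<longleftrightarrow> (\<exists>G\<in>C. eventually (\<lambda>x. False) G)"
      proof (rule eventually_Inf_base[OF False])
        show "\<exists>x\<in>C. x \<le> inf G H" if "G \<in> C" "H \<in> C" for G H
          using chain[OF that] that by (metis inf.absorb_iff1 inf.absorb_iff2 order_refl)
      qed
      then have "Inf C \<noteq> bot" using sub by (auto simp: trivial_limit_def)
      moreover have "Inf C \<le> F" using False sub by (auto intro: Inf_lower2)
      ultimately show ?thesis by (auto intro: Inf_lower)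
    qed
  qed
  then obtain U where U: "U \<le> F" "U \<noteq> bot" "\<And>G. G \<le> U \<Longrightarrow> G \<noteq> bot \<Longrightarrow> G = U"
    by auto
  \<comment> \<open>Restricting \<open>U\<close> to \<open>P\<close> either gives the improper
    filter, so \<open>U\<close> contains the complement, or gives \<open>U\<close> back by
    minimality.\<close>
  have "eventually P U \<or> eventually (\<lambda>x. \<not> P x) U" for P
  proof (cases "inf U (principal {x. P x}) = bot")
    case True
    then show ?thesis by (simp add: trivial_limit_def eventually_inf_principal)
  next
    case False
    then have "inf U (principal {x. P x}) = U" using U(3) by simp
    then have "U \<le> principal {x. P x}" by (simp add: le_iff_inf)
    then show ?thesis by (simp add: le_principal)
  qed
  with U show ?thesis by (auto simp: ultra_def)
qed

section \<open>Trees on \<open>\<omega>\<^sub>1\<close> with levels \<open>[\<omega>\<alpha>, \<omega>\<alpha> + \<omega>)\<close>\<close>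

text \<open>The index of the level of \<open>t\<close>, so that heights can be handled as elements
  of \<open>omega1\<close> instead of well-order relations.\<close>

definition block :: "omega1 \<Rightarrow> omega1"
  where "block t = (THE \<alpha>. omega * \<alpha> \<le> t \<and> t < omega * \<alpha> + omega)"

lemma block_eqI: "omega * \<alpha> \<le> t \<Longrightarrow> t < omega * \<alpha> + omega \<Longrightarrow> block t = \<alpha>"
  unfolding block_def by (rule the_equality) (auto intro: omega_block_unique)

lemma block_bounds: "omega * block t \<le> t" "t < omega * block t + omega"
  using omega_block_exists[of t] block_eqI by auto

text \<open>Level \<open>\<delta>\<close> starts at \<open>\<delta>\<close> itself when
  \<open>omega * \<delta> = \<delta>\<close>, so bounds on nodes and bounds on levels agree
  there.\<close>

lemma block_less_iff:
  assumes "\<delta> \<in> omega_fixpoints"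
  shows "block t < \<delta> \<longleftrightarrow> t < \<delta>"
proof -
  have \<delta>: "omega * \<delta> = \<delta>" using assms by (simp add: omega_fixpoints_def)
  show ?thesis
  proof
    assume "block t < \<delta>"
    then show "t < \<delta>" using times_plus_le[of "block t" \<delta> omega] block_bounds(2)[of t] \<delta> by simp
  next
    assume "t < \<delta>"
    then show "block t < \<delta>"
      using omega_times_mono[of \<delta> "block t"] block_bounds(1)[of t] \<delta> by (force simp: not_less)
  qed
qed

lemma block_eq_fixpoint_iff:
  assumes "\<delta> \<in> omega_fixpoints"
  shows "block t = \<delta> \<longleftrightarrow> (\<exists>m. t = \<delta> + ord_of_nat m)"
proof -
  have \<delta>: "omega * \<delta> = \<delta>" using assms by (simp add: omega_fixpoints_def)
  show ?thesis
  proof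
    assume "block t = \<delta>"
    then show "\<exists>m. t = \<delta> + ord_of_nat m"
      using block_bounds[of t] \<delta> by (intro plus_omega_block) simp_all
  next
    assume "\<exists>m. t = \<delta> + ord_of_nat m"
    then show "block t = \<delta>"
      using plus_ord_of_nat_bounds[of \<delta>] \<delta> by (intro block_eqI) auto
  qed
qed

lemma Field_ord_below: "Field (ord_below \<alpha>) = {..<\<alpha>}"
  by (auto simp: Field_def ord_below_def)

lemma Field_height: "Field (height T t) = preds T t"
  by (auto simp: Field_def height_def)

section \<open>The tree order in terms of level indices\<close>

locale omega_block_tree =
  fixes T :: "omega1 \<Rightarrow> omega1 \<Rightarrow> bool"
  assumes omega1_tree: "omega1_tree T"
    and normal: "normal_tree T"
    and levels: "level T (ord_below \<alpha>) = {omega * \<alpha> ..< omega * \<alpha> + omega}"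
begin

lemma T_irrefl: "\<not> T x x" and T_trans: "T x y \<Longrightarrow> T y z \<Longrightarrow> T x z"
  and Well_order_height: "Well_order (height T t)"
  and tree_height: "tree_height T ord_omega1"
  using omega1_tree by (auto simp: omega1_tree_def is_tree_def irreflp_def Field_height dest: transpD)

lemma T_linear: "T x t \<Longrightarrow> T y t \<Longrightarrow> x = y \<or> T x y \<or> T y x"
proof -
  assume "T x t" "T y t"
  then have "x \<in> preds T t" "y \<in> preds T t" by (simp_all add: preds_def)
  moreover have "total_on (preds T t) (height T t)"
    using Well_order_height[of t] by (simp add: well_order_on_def linear_order_on_def Field_height)
  ultimately show ?thesis by (auto simp: total_on_def height_def)
qed

lemma Well_order_ord_omega1: "Well_order ord_omega1"
  using tree_height by (simp add: tree_height_def)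

lemma ord_below_Restr: "ord_below \<alpha> = Restr ord_omega1 (underS ord_omega1 \<alpha>)"
  by (auto simp: ord_below_def ord_omega1_def underS_def)

lemma Well_order_ord_below: "Well_order (ord_below \<alpha>)"
  unfolding ord_below_Restr by (rule Well_order_Restr[OF Well_order_ord_omega1])

lemma ord_below_less_omega1: "ord_below \<alpha> <o ord_omega1"
  unfolding ord_below_Restr
  by (rule underS_Restr_ordLess[OF Well_order_ord_omega1]) (auto simp: Field_def ord_omega1_def)

lemma ord_below_mono_strict:
  assumes "\<beta> < \<alpha>"
  shows "ord_below \<beta> <o ord_below \<alpha>"
proof -
  have "ord_below \<beta> = Restr (ord_below \<alpha>) (underS (ord_below \<alpha>) \<beta>)"
    using assms by (auto simp: ord_below_def underS_def)
  moreover have "Field (ord_below \<alpha>) \<noteq> {}" using assms by (auto simp: Field_ord_below)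
  ultimately show ?thesis using underS_Restr_ordLess[OF Well_order_ord_below[of \<alpha>]] by simp
qed

lemma level_ord_below_iff: "t \<in> level T (ord_below \<alpha>) \<longleftrightarrow> block t = \<alpha>"
  using block_bounds[of t] by (auto simp: levels intro: block_eqI)

lemma height_ordIso: "height T t =o ord_below (block t)"
  using level_ord_below_iff[of t "block t"] by (simp add: level_def)

text \<open>Take the isomorphism \<open>f\<close> from the ordinal \<open>block t\<close> onto the
  predecessors of \<open>t\<close>. Its restriction to \<open>\<beta>\<close> is an isomorphism onto
  the predecessors of \<open>f \<beta>\<close>, which puts \<open>f \<beta>\<close> on level
  \<open>\<beta>\<close>.\<close>

lemma preds_enumeration:
  obtains f where "f ` {..<block t} = preds T t" "\<And>\<beta>. \<beta> < block t \<Longrightarrow> block (f \<beta>) = \<beta>"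
proof -
  obtain f where f: "BNF_Wellorder_Embedding.iso (ord_below (block t)) (height T t) f"
    using ordIso_symmetric[OF height_ordIso[of t]] by (auto simp: ordIso_def)
  have bij: "bij_betw f {..<block t} (preds T t)"
    using f by (auto simp: iso_iff2 Field_ord_below Field_height)
  have ord: "x \<le> y \<longleftrightarrow> f x = f y \<or> T (f x) (f y)" if "x < block t" "y < block t" for x y
  proof -
    have "(x, y) \<in> ord_below (block t) \<longleftrightarrow> (f x, f y) \<in> height T t"
      using f that by (simp add: iso_iff2 Field_ord_below)
    then show ?thesis using bij_betwE[OF bij] that by (simp add: height_def ord_below_def)
  qed
  have "block (f \<beta>) = \<beta>" if \<beta>: "\<beta> < block t" for \<beta>
  proof -
    have f\<beta>: "T (f \<beta>) t" using bij_betwE[OF bij] \<beta> by (auto simp: preds_def)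
    have preds: "preds T (f \<beta>) = f ` {..<\<beta>}"
    proof (intro equalityI subsetI)
      fix s assume "s \<in> preds T (f \<beta>)"
      then have s: "T s (f \<beta>)" by (simp add: preds_def)
      then have "s \<in> preds T t" using T_trans f\<beta> by (auto simp: preds_def)
      then obtain \<gamma> where \<gamma>: "\<gamma> < block t" "s = f \<gamma>" using bij by (auto simp: bij_betw_def)
      then have "\<not> \<beta> \<le> \<gamma>" using ord[OF \<beta> \<gamma>(1)] s T_irrefl T_trans by metis
      then show "s \<in> f ` {..<\<beta>}" using \<gamma> by auto
    next
      fix s assume "s \<in> f ` {..<\<beta>}"
      then obtain \<gamma> where \<gamma>: "\<gamma> < \<beta>" "s = f \<gamma>" by auto
      then have "\<gamma> < block t" using \<beta> by auto
      then have "\<not> (f \<beta> = f \<gamma> \<or> T (f \<beta>) (f \<gamma>))" "f \<gamma> = f \<beta> \<or> T (f \<gamma>) (f \<beta>)"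
        using ord[OF \<beta>, of \<gamma>] ord[of \<gamma> \<beta>] \<beta> \<gamma>(1)
        by (simp_all add: less_imp_le flip: not_le)
      then show "s \<in> preds T (f \<beta>)" using \<gamma> by (auto simp: preds_def)
    qed
    have "inj_on f {..<\<beta>}"
      using bij \<beta> by (auto simp: bij_betw_def intro: inj_on_subset)
    then have "bij_betw f {..<\<beta>} (preds T (f \<beta>))" by (simp add: preds bij_betw_def)
    moreover have "(x, y) \<in> ord_below \<beta> \<longleftrightarrow> (f x, f y) \<in> height T (f \<beta>)" if "x < \<beta>" "y < \<beta>" for x y
      using ord[of x y] that \<beta> by (auto simp: ord_below_def height_def preds)
    ultimately have "BNF_Wellorder_Embedding.iso (ord_below \<beta>) (height T (f \<beta>)) f"
      by (auto simp: iso_iff2 Field_ord_below Field_height)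
    then have "ord_below \<beta> =o height T (f \<beta>)"
      using Well_order_ord_below Well_order_height by (auto simp: ordIso_def)
    then show ?thesis
      using level_ord_below_iff[of "f \<beta>" \<beta>] ordIso_symmetric by (auto simp: level_def)
  qed
  moreover have "f ` {..<block t} = preds T t" using bij by (simp add: bij_betw_def)
  ultimately show thesis using that by blast
qed

lemma block_mono_strict:
  assumes "T s t"
  shows "block s < block t"
proof -
  obtain f where "f ` {..<block t} = preds T t" "\<And>\<beta>. \<beta> < block t \<Longrightarrow> block (f \<beta>) = \<beta>"
    using preds_enumeration[of t] by metis
  then show ?thesis using assms by (force simp: preds_def)
qed

lemma pred_at_level:
  assumes "\<beta> < block t"
  obtains s where "T s t" "block s = \<beta>"
proof -
  obtain f where "f ` {..<block t} = preds T t" "\<And>\<beta>. \<beta> < block t \<Longrightarrow> block (f \<beta>) = \<beta>"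
    using preds_enumeration[of t] by metis
  then have "f \<beta> \<in> preds T t" "block (f \<beta>) = \<beta>" using assms by auto
  then show thesis using that by (simp add: preds_def)
qed

text \<open>Normality, with \<open>ord_below \<alpha>\<close> representing the target level and
  \<open>ord_omega1\<close> the height of the tree.\<close>

lemma succ_at_level:
  assumes "block s < \<alpha>"
  obtains t where "T s t" "block t = \<alpha>"
proof -
  have "height T s <o ord_below \<alpha>"
    using height_ordIso ord_below_mono_strict[OF assms] by (rule ordIso_ordLess_trans)
  then obtain t where "t \<in> level T (ord_below \<alpha>)" "T s t"
    using normal tree_height ord_below_less_omega1 unfolding normal_tree_def by blast
  then show thesis using that by (auto simp: level_ord_below_iff)
qed

lemma T_below_pred:
  assumes "T x t" "T y t" "block x < block y"
  shows "T x y"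
  using T_linear[OF assms(1,2)] assms(3) block_mono_strict[of y x] by auto

text \<open>Whatever the order of \<open>\<alpha>\<close> and \<open>\<delta>\<close>: restrict \<open>\<alpha> + m\<close> to level \<open>\<delta>\<close> or extend it to that level.\<close>

lemma branch_transfer:
  assumes "\<alpha> \<in> omega_fixpoints" "\<delta> \<in> omega_fixpoints"
  shows "\<exists>j. \<forall>x<\<delta>. T x (\<alpha> + ord_of_nat m) \<longrightarrow> T x (\<delta> + ord_of_nat j)"
proof -
  let ?t = "\<alpha> + ord_of_nat m"
  have bt: "block ?t = \<alpha>" using block_eq_fixpoint_iff[OF assms(1)] by blast
  have "\<exists>s. block s = \<delta> \<and> (\<forall>x<\<delta>. T x ?t \<longrightarrow> T x s)"
  proof (rule linorder_cases[of \<alpha> \<delta>])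
    assume "\<alpha> < \<delta>"
    then obtain s where "T ?t s" "block s = \<delta>" using succ_at_level[of ?t \<delta>] bt by auto
    then show ?thesis using T_trans by blast
  next
    assume "\<alpha> = \<delta>"
    then show ?thesis using bt by blast
  next
    assume "\<delta> < \<alpha>"
    then obtain s where "T s ?t" "block s = \<delta>" using pred_at_level[of \<delta> ?t] bt by auto
    then show ?thesis using T_below_pred block_less_iff[OF assms(2)] by blast
  qed
  then show ?thesis using block_eq_fixpoint_iff[OF assms(2)] by metis
qed

section \<open>The family of the tree and the topology it generates\<close>

lemma F_set_transfer:
  assumes "\<alpha> \<in> omega_fixpoints" "\<delta> \<in> omega_fixpoints"
  shows "\<exists>j. F_set T n \<alpha> \<inter> {..<\<delta>} \<subseteq> F_set T j \<delta>"
proof -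
  obtain g where g: "\<And>m x. x < \<delta> \<Longrightarrow> T x (\<alpha> + ord_of_nat m) \<Longrightarrow> T x (\<delta> + ord_of_nat (g m))"
    using branch_transfer[OF assms] by metis
  \<comment> \<open>Each of the branches below \<open>\<alpha> + m\<close>,
    \<open>m \<le> n\<close>, continues to be covered by one node of level \<open>\<delta>\<close>;
    the largest index serves them all.\<close>
  have "F_set T n \<alpha> \<inter> {..<\<delta>} \<subseteq> F_set T (Max (g ` {..n})) \<delta>"
    by (auto simp: F_set_def intro!: exI[of _ "g _"] Max_ge dest: g)
  then show ?thesis ..
qed

lemma F_set_mono: "i \<le> j \<Longrightarrow> F_set T i \<alpha> \<subseteq> F_set T j \<alpha>"
  by (auto simp: F_set_def intro: order.trans)

lemma F_family_directed:
  assumes "E \<in> F_family T" "F \<in> F_family T"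
  shows "\<exists>H\<in>F_family T. E \<union> F \<subseteq> H"
proof -
  obtain m \<alpha> n \<beta> where EF: "E = F_set T m \<alpha>" "F = F_set T n \<beta>"
    and C: "\<alpha> \<in> omega_fixpoints" "\<beta> \<in> omega_fixpoints"
    using assms by (auto simp: F_family_def)
  \<comment> \<open>Both sets lie below the maximum, so transferring them there loses
    nothing.\<close>
  define \<delta> where "\<delta> = max \<alpha> \<beta>"
  have \<delta>: "\<delta> \<in> omega_fixpoints" using C by (simp add: \<delta>_def max_def)
  obtain i j where "F_set T m \<alpha> \<inter> {..<\<delta>} \<subseteq> F_set T i \<delta>" "F_set T n \<beta> \<inter> {..<\<delta>} \<subseteq> F_set T j \<delta>"
    using F_set_transfer C \<delta> by meson
  moreover have "E \<subseteq> {..<\<delta>}" "F \<subseteq> {..<\<delta>}" by (auto simp: EF F_set_def \<delta>_def less_max_iff_disj)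
  ultimately have "E \<union> F \<subseteq> F_set T (max i j) \<delta>"
    using F_set_mono[of i "max i j" \<delta>] F_set_mono[of j "max i j" \<delta>] EF by auto
  then show ?thesis using \<delta> by (auto simp: F_family_def)
qed

abbreviation "G \<equiv> G_topology (F_family T)"

lemma G_topology_char:
  "topological_group finset_group G" "open_nbhd_base G {} (avoiding ` F_family T)"
proof -
  have "F_family T \<noteq> {}" using omega_fixpoints_closed_under by (auto simp: F_family_def)
  from theI'[OF ex1_G_topology[OF this F_family_directed]]
  show "topological_group finset_group G" "open_nbhd_base G {} (avoiding ` F_family T)"
    by (simp_all add: G_topology_def)
qed

lemma topspace_G: "topspace G = {a. finite a}"
  using G_topology_char(1) by (simp add: topological_group_def)

text \<open>Upward closed properties need testing only on a neighbourhood base; closure and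
  convergence are both of this kind.\<close>

lemma all_nbhds_iff:
  assumes mono: "\<And>U V. U \<subseteq> V \<Longrightarrow> P U \<Longrightarrow> P V"
  shows "(\<forall>U. openin G U \<and> {} \<in> U \<longrightarrow> P U) \<longleftrightarrow>
    (\<forall>n. \<forall>\<delta>\<in>omega_fixpoints. P (avoiding (F_set T n \<delta>)))" (is "?L \<longleftrightarrow> ?R")
proof
  assume ?L
  then have "P (avoiding F)" if "F \<in> F_family T" for F
    using G_topology_char(2) that by (simp add: open_nbhd_base_def)
  then show ?R by (auto simp: F_family_def)
next
  assume R: ?R
  show ?L
  proof (intro allI impI)
    fix U assume "openin G U \<and> {} \<in> U"
    then have "\<exists>B\<in>avoiding ` F_family T. B \<subseteq> U"
      using G_topology_char(2) by (simp only: open_nbhd_base_def)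
    then obtain B where B: "B \<in> avoiding ` F_family T" "B \<subseteq> U" by (elim bexE)
    then have "P B" using R by (auto simp: F_family_def)
    then show "P U" by (rule mono[OF B(2)])
  qed
qed

lemma closure_empty_iff:
  assumes "A \<subseteq> {a. finite a}"
  shows "{} \<in> G closure_of A \<longleftrightarrow>
    (\<forall>n. \<forall>\<delta>\<in>omega_fixpoints. \<exists>a\<in>A. a \<inter> F_set T n \<delta> = {})"
proof -
  have "{} \<in> G closure_of A \<longleftrightarrow> (\<forall>U. openin G U \<and> {} \<in> U \<longrightarrow> (\<exists>a\<in>A. a \<in> U))"
    by (auto simp: in_closure_of topspace_G)
  also have "\<dots> \<longleftrightarrow> (\<forall>n. \<forall>\<delta>\<in>omega_fixpoints. \<exists>a\<in>A. a \<in> avoiding (F_set T n \<delta>))"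
    by (rule all_nbhds_iff) blast
  moreover have "(\<exists>a\<in>A. a \<in> avoiding F) \<longleftrightarrow> (\<exists>a\<in>A. a \<inter> F = {})" for F
    using assms by (auto simp: avoiding_def)
  ultimately show ?thesis by simp
qed

lemma limitin_empty_iff:
  assumes "range \<sigma> \<subseteq> {a. finite a}"
  shows "limitin G \<sigma> {} sequentially \<longleftrightarrow>
    (\<forall>n. \<forall>\<delta>\<in>omega_fixpoints. eventually (\<lambda>k. \<sigma> k \<inter> F_set T n \<delta> = {}) sequentially)"
proof -
  have "limitin G \<sigma> {} sequentially \<longleftrightarrow>
      (\<forall>U. openin G U \<and> {} \<in> U \<longrightarrow> eventually (\<lambda>k. \<sigma> k \<in> U) sequentially)"
    by (simp add: limitin_def topspace_G)
  also have "\<dots> \<longleftrightarrow>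
      (\<forall>n. \<forall>\<delta>\<in>omega_fixpoints. eventually (\<lambda>k. \<sigma> k \<in> avoiding (F_set T n \<delta>)) sequentially)"
    by (rule all_nbhds_iff) (auto elim: eventually_mono)
  moreover have "\<sigma> k \<in> avoiding F \<longleftrightarrow> \<sigma> k \<inter> F = {}" for k F
    using assms by (auto simp: avoiding_def)
  ultimately show ?thesis by simp
qed

text \<open>Reduces the topological question to the combinatorics of finite sets and the sets
  \<open>F_set T n \<delta>\<close>.\<close>

lemma frechet_iff:
  "frechet_group finset_group G \<longleftrightarrow>
    (\<forall>A\<subseteq>{a. finite a}. (\<forall>n. \<forall>\<delta>\<in>omega_fixpoints. \<exists>a\<in>A. a \<inter> F_set T n \<delta> = {}) \<longrightarrow>
      (\<exists>\<sigma> :: nat \<Rightarrow> _. range \<sigma> \<subseteq> A \<and>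
        (\<forall>n. \<forall>\<delta>\<in>omega_fixpoints. eventually (\<lambda>k. \<sigma> k \<inter> F_set T n \<delta> = {}) sequentially)))"
  unfolding frechet_group_def finset_group_simps
  by (intro all_cong imp_cong refl ex_cong conj_cong closure_empty_iff)
    (auto intro!: limitin_empty_iff)

section \<open>The Frechet property and uncountable chains\<close>

lemma not_frechet_if_uncountable_chain:
  assumes chain: "\<forall>x\<in>B. \<forall>y\<in>B. x = y \<or> T x y \<or> T y x" and "uncountable B"
  shows "\<not> frechet_group finset_group G"
proof
  assume fr: "frechet_group finset_group G"
  have unb: "\<exists>x\<in>B. \<beta> < x" for \<beta> using assms(2) by (simp add: omega1_unbounded_iff)
  define A where "A = (\<lambda>x. {x}) ` B"
  have "\<exists>a\<in>A. a \<inter> F_set T n \<delta> = {}" for n \<delta>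
  proof -
    obtain x where "x \<in> B" "\<delta> < x" using unb by blast
    then have "{x} \<in> A" "{x} \<inter> F_set T n \<delta> = {}" by (auto simp: A_def F_set_def)
    then show ?thesis by blast
  qed
  moreover have "A \<subseteq> {a. finite a}" by (auto simp: A_def)
  ultimately obtain \<sigma> :: "nat \<Rightarrow> _" where \<sigma>: "range \<sigma> \<subseteq> A"
    and conv: "\<And>n \<delta>. \<delta> \<in> omega_fixpoints \<Longrightarrow> eventually (\<lambda>k. \<sigma> k \<inter> F_set T n \<delta> = {}) sequentially"
    using fr unfolding frechet_iff by meson
  have "\<forall>k. \<exists>x\<in>B. \<sigma> k = {x}" using \<sigma> by (auto simp: A_def)
  then obtain x where x: "\<And>k. x k \<in> B" "\<And>k. \<sigma> k = {x k}" by metis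
  \<comment> \<open>The sequence is bounded, so some fixed point \<open>\<delta>\<close> and then a
    chain member \<open>y\<close> lie above it. Comparability and the lower level of
    \<open>x k\<close> force \<open>T (x k) y\<close>.\<close>
  obtain b where b: "\<And>k. x k < b" using bounded_omega1[of "range x"] by auto
  obtain \<delta> where \<delta>: "\<delta> \<in> omega_fixpoints" "b < \<delta>" using omega_fixpoints_closed_under by blast
  obtain y where y: "y \<in> B" "\<delta> < y" using unb by blast
  have le_y: "\<delta> \<le> block y" using y block_less_iff[OF \<delta>(1), of y] by (simp add: not_less[symmetric])
  have x\<delta>: "x k < \<delta>" "block (x k) < \<delta>" for k using b \<delta> block_less_iff by (metis order.strict_trans)+
  have xy: "T (x k) y" for k
    using chain x(1)[of k] y(1) x\<delta>[of k] le_y block_mono_strict[of y "x k"] by force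
  \<comment> \<open>\<open>z\<close> is \<open>y\<close> or its predecessor on level
    \<open>\<delta>\<close>. As \<open>z\<close> is some \<open>\<delta> + m\<close>, every
    \<open>\<sigma> k\<close> meets \<open>F_set T m \<delta>\<close>, which contradicts
    convergence.\<close>
  obtain z where z: "block z = \<delta>" "\<And>k. T (x k) z"
  proof (cases "block y = \<delta>")
    case True
    then show ?thesis using that xy by blast
  next
    case False
    then have "\<delta> < block y" using le_y by simp
    then obtain z where z: "T z y" "block z = \<delta>" by (rule pred_at_level)
    then show ?thesis using that[of z] T_below_pred[OF xy z(1)] x\<delta> by auto
  qed
  then obtain m where m: "z = \<delta> + ord_of_nat m" using block_eq_fixpoint_iff[OF \<delta>(1)] by auto
  then have "\<sigma> k \<inter> F_set T m \<delta> \<noteq> {}" for k using z x\<delta> x(2) by (auto simp: F_set_def)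
  then show False using conv[OF \<delta>(1), of m] by simp
qed

text \<open>If there were no such \<open>\<delta>\<close>, fix by pressing down the bound \<open>n\<close> and the part below \<open>\<delta>\<close> of a member
  of \<open>A\<close> avoiding \<open>F_set T n \<delta>\<close>, for uncountably many \<open>\<delta>\<close>.  An ultrafilter on these \<open>\<delta>\<close> turns the
  nodes \<open>\<delta> + m\<close>, \<open>m \<le> n\<close>, into finitely many chains, countable by the Aronszajn property, whose union
  is bounded and meets every member of \<open>A\<close>; a member chosen for a \<open>\<delta>\<close> above the bound meets it in
  the fixed part, contradicting the choice.\<close>

lemma aronszajn_reflection:
  assumes chains: "\<And>B. \<forall>x\<in>B. \<forall>y\<in>B. x = y \<or> T x y \<or> T y x \<Longrightarrow> countable B"
    and fin: "\<And>a. a \<in> A \<Longrightarrow> finite a"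
    and avoid: "\<And>n \<delta>. \<delta> \<in> omega_fixpoints \<Longrightarrow> \<exists>a\<in>A. a \<inter> F_set T n \<delta> = {}"
  shows "\<exists>\<delta>\<in>omega_fixpoints. \<forall>n. \<exists>a\<in>A. a \<subseteq> {..<\<delta>} \<and> a \<inter> F_set T n \<delta> = {}"
proof (rule ccontr)
  assume "\<not> ?thesis"
  then obtain N where N: "\<And>\<delta> a. \<delta> \<in> omega_fixpoints \<Longrightarrow> a \<in> A \<Longrightarrow> a \<subseteq> {..<\<delta>} \<Longrightarrow>
      a \<inter> F_set T (N \<delta>) \<delta> \<noteq> {}"
    by metis
  have "\<forall>\<delta>\<in>omega_fixpoints. \<exists>a. a \<in> A \<and> a \<inter> F_set T (N \<delta>) \<delta> = {}"
    using avoid by blast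
  from bchoice[OF this]
  obtain a where a: "\<And>\<delta>. \<delta> \<in> omega_fixpoints \<Longrightarrow> a \<delta> \<in> A \<and> a \<delta> \<inter> F_set T (N \<delta>) \<delta> = {}"
    by blast
  obtain n r where unc: "uncountable {\<delta>\<in>omega_fixpoints. N \<delta> = n \<and> a \<delta> \<inter> {..<\<delta>} = r}"
    using pressing_down_finite[of "\<lambda>\<delta>. a \<delta> \<inter> {..<\<delta>}" N] a fin by auto
  define S where "S = {\<delta>\<in>omega_fixpoints. N \<delta> = n \<and> a \<delta> \<inter> {..<\<delta>} = r}"
  have unb: "\<exists>\<delta>\<in>S. \<beta> < \<delta>" for \<beta> using unc unfolding omega1_unbounded_iff S_def by blast
  \<comment> \<open>Since \<open>S\<close> is unbounded, its tails generate a proper filter; an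
    ultrafilter \<open>U\<close> refining it contains \<open>S\<close> and every tail.\<close>
  have "inf at_top (principal S) \<noteq> bot"
    using unb by (auto simp: trivial_limit_def eventually_inf_principal eventually_at_top_linorder)
      (metis less_imp_le)
  then obtain U where U: "U \<le> inf at_top (principal S)" "ultra U" using ultra_exists by blast
  have ev_S: "eventually (\<lambda>\<delta>. \<delta> \<in> S) U" using U(1) by (simp add: le_principal)
  have ev_gt: "eventually (\<lambda>\<delta>. \<beta> < \<delta>) U" for \<beta>
  proof -
    have "eventually (\<lambda>\<delta>. succ1 \<beta> \<le> \<delta>) U"
      using U(1) eventually_ge_at_top by (auto intro: filter_leD)
    then show ?thesis by eventually_elim (use less_succ1 order.strict_trans2 in blast)
  qed
  \<comment> \<open>\<open>W m\<close> is the limit along \<open>U\<close> of the branches below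
    \<open>\<delta> + m\<close>. Any two of its nodes lie below a common
    \<open>\<delta> + m\<close>, so it is a chain.\<close>
  define W where "W m = {x. eventually (\<lambda>\<delta>. T x (\<delta> + ord_of_nat m)) U}" for m
  have "countable (W m)" for m
  proof (rule chains, intro ballI)
    fix x y assume "x \<in> W m" "y \<in> W m"
    then have "eventually (\<lambda>\<delta>. T x (\<delta> + ord_of_nat m) \<and> T y (\<delta> + ord_of_nat m)) U"
      by (simp add: W_def eventually_conj)
    then obtain \<delta> where "T x (\<delta> + ord_of_nat m)" "T y (\<delta> + ord_of_nat m)"
      using U(2) eventually_happens'[of U] by (auto simp: ultra_def)
    then show "x = y \<or> T x y \<or> T y x" by (rule T_linear)
  qed
  then obtain \<beta> where \<beta>: "\<And>m x. x \<in> W m \<Longrightarrow> x < \<beta>"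
    using bounded_omega1[of "\<Union>m. W m"] by auto
  obtain \<delta> where \<delta>: "\<delta> \<in> S" "\<beta> < \<delta>" using unb by blast
  have fin\<delta>: "finite (a \<delta>)" "a \<delta> \<in> A" using \<delta> a fin by (auto simp: S_def)
  have "eventually (\<lambda>\<delta>'. \<forall>x\<in>a \<delta>. x < \<delta>') U" using ev_gt fin\<delta> by (simp add: eventually_ball_finite)
  \<comment> \<open>For almost all \<open>\<delta>'\<close> the set \<open>a \<delta>\<close> lies
    below \<open>\<delta>'\<close> and \<open>N \<delta>' = n\<close>, so it meets
    \<open>F_set T n \<delta>'\<close>. The witnessing pairs come from a finite set, so
    \<open>U\<close> settles on one of them.\<close>
  with ev_S have "eventually (\<lambda>\<delta>'. \<exists>p\<in>a \<delta> \<times> {..n}. T (fst p) (\<delta>' + ord_of_nat (snd p))) U"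
  proof eventually_elim
    case (elim \<delta>')
    then have "a \<delta> \<inter> F_set T n \<delta>' \<noteq> {}" using N[of \<delta>' "a \<delta>"] fin\<delta> by (auto simp: S_def)
    then show ?case by (force simp: F_set_def)
  qed
  then obtain x m where x: "x \<in> a \<delta>" "m \<le> n" "eventually (\<lambda>\<delta>'. T x (\<delta>' + ord_of_nat m)) U"
    using ultra_bex_finite[OF U(2), of "a \<delta> \<times> {..n}" "\<lambda>p \<delta>'. T (fst p) (\<delta>' + ord_of_nat (snd p))"]
      fin\<delta> by auto
  \<comment> \<open>\<open>x\<close> is in \<open>W m\<close>, hence below \<open>\<beta>\<close>
    and in the common trace \<open>r\<close>. So it is in \<open>a \<delta>'\<close> for almost all
    \<open>\<delta>'\<close>, although \<open>a \<delta>'\<close> avoids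
    \<open>F_set T n \<delta>'\<close>.\<close>
  then have "x < \<delta>" using \<beta>[of x m] \<delta> by (auto simp: W_def)
  then have "x \<in> r" using x \<delta> by (auto simp: S_def)
  have "eventually (\<lambda>\<delta>'. False) U"
    using ev_S ev_gt[of x] x(3)
  proof eventually_elim
    case (elim \<delta>')
    then have "x \<in> a \<delta>' \<inter> F_set T n \<delta>'" using \<open>x \<in> r\<close> x(2) by (auto simp: S_def F_set_def)
    then show ?case using a[of \<delta>'] elim by (auto simp: S_def)
  qed
  then show False using U(2) by (simp add: ultra_def)
qed

lemma frechet_if_chains_countable:
  assumes chains: "\<And>B. \<forall>x\<in>B. \<forall>y\<in>B. x = y \<or> T x y \<or> T y x \<Longrightarrow> countable B"
  shows "frechet_group finset_group G"
  unfolding frechet_iff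
proof (intro allI impI)
  fix A :: "omega1 set set"
  assume A: "A \<subseteq> {a. finite a}"
    and avoid: "\<forall>n. \<forall>\<delta>\<in>omega_fixpoints. \<exists>a\<in>A. a \<inter> F_set T n \<delta> = {}"
  obtain \<delta> where \<delta>: "\<delta> \<in> omega_fixpoints"
    and "\<forall>n. \<exists>a\<in>A. a \<subseteq> {..<\<delta>} \<and> a \<inter> F_set T n \<delta> = {}"
    using aronszajn_reflection[OF chains, of A] A avoid by blast
  then obtain \<sigma> where \<sigma>: "\<And>n. \<sigma> n \<in> A" "\<And>n. \<sigma> n \<subseteq> {..<\<delta>}" "\<And>n. \<sigma> n \<inter> F_set T n \<delta> = {}"
    by metis
  have "eventually (\<lambda>k. \<sigma> k \<inter> F_set T n \<alpha> = {}) sequentially" if \<alpha>: "\<alpha> \<in> omega_fixpoints" for n \<alpha>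
  proof -
    obtain j where j: "F_set T n \<alpha> \<inter> {..<\<delta>} \<subseteq> F_set T j \<delta>"
      using F_set_transfer[OF \<alpha> \<delta>] by blast
    \<comment> \<open>Only the trace of \<open>F_set T n \<alpha>\<close> on \<open>\<delta>\<close>
      can meet \<open>\<sigma> k\<close>, and for \<open>k \<ge> j\<close> that trace is inside
      \<open>F_set T k \<delta>\<close>.\<close>
    have "\<sigma> k \<inter> F_set T n \<alpha> = {}" if "j \<le> k" for k
      using \<sigma>(2,3)[of k] j F_set_mono[OF that, of \<delta>] by blast
    then show ?thesis by (auto simp: eventually_sequentially)
  qed
  then show "\<exists>\<sigma>. range \<sigma> \<subseteq> A \<and>
      (\<forall>n. \<forall>\<delta>\<in>omega_fixpoints. eventually (\<lambda>k. \<sigma> k \<inter> F_set T n \<delta> = {}) sequentially)"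
    using \<sigma>(1) by (intro exI[of _ \<sigma>]) auto
qed

end

theorem theorem6p5:
  fixes T :: "omega1 \<Rightarrow> omega1 \<Rightarrow> bool"
  assumes "omega1_tree T"
    and "normal_tree T"
    and "omega_splitting T"
    and "\<And>\<alpha>. level T (ord_below \<alpha>) = {omega * \<alpha> ..< omega * \<alpha> + omega}"
  shows "frechet_group finset_group (G_topology (F_family T)) \<longleftrightarrow> aronszajn T"
proof -
  interpret omega_block_tree T by unfold_locales (fact assms)+
  show ?thesis
    unfolding aronszajn_def
    by (metis (no_types, lifting) assms(1) frechet_if_chains_countable not_frechet_if_uncountable_chain)
qed

end
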